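(* Let $\rho$ be a density operator on the one-particle space $\mathcal{H}_1^{\bm{\mathsf{A}}}=\mathrm{span}\{|\mathbf{e}_1\rangle,\dots,|\mathbf{e}_N\rangle\}$, and let $\rho_{ij}=\langle\mathbf{e}_i|\rho|\mathbf{e}_j\rangle$. Then for all $i\neq j$, $$I_2^{(i,j)}(\rho)=4|\rho_{ij}|.$$ Moreover, this value can be attained by parties $i$ and $j$ performing a $\{0,\pi\}$ encoding, i.e. $\mathcal{E}_a(X)=\sigma_z^a X\sigma_z^a$ for $a\in\{0,1\}$, where $\sigma_z=|0\rangle\langle0|+e^{i\pi}|1\rangle\langle1|$.
   Context: There are $N$ senders; sender $i$ holds a mode with Hilbert space $\mathbb{C}^2$ with basis $|0\rangle$ (vacuum), $|1\rangle$ (one particle). $|\mathbf{e}_i\rangle\in(\mathbb{C}^2)^{\otimes N}$ is the product state with $|1\rangle$ on mode $i$ and $|0\rangle$ on all other modes. Input sets $\mathcal{A}_i$ and the output set $\mathcal{B}$ are finite with at least two elements; $\bm{\mathcal{A}}=\prod_i\mathcal{A}_i$. A number-preserving extendible (NPE) operation on a single mode (with at most one particle) is a convex combination of channels with Kraus operators $\begin{pmatrix}1&0\\0&y\end{pmatrix},\begin{pmatrix}0&z\\0&0\end{pmatrix}$, $y,z\in\mathbb{C}$, $|y|^2+|z|^2=1$. $\mathcal{Q}_N(\rho)=\mathcal{Q}_N(\bm{\mathcal{A}};\mathcal{B};\rho)$ is the set of all MACs (conditional distributions) $p(b|a_1\cdots a_N)=\mathrm{Tr}\left[\Pi_b\,(\mathcal{E}^{(1)}_{a_1}\otimes\cdots\otimes\mathcal{E}^{(N)}_{a_N})(\rho)\right]$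 where each $\mathcal{E}^{(i)}_{a_i}$ ($a_i\in\mathcal{A}_i$) is an NPE operation on mode $i$ and $\{\Pi_b\}_{b\in\mathcal{B}}$ is a POVM on $(\mathbb{C}^2)^{\otimes N}$. For a MAC $\mathbf{p}$ and $i\ne j$, $I_2^{(i,j)}(\mathbf{p})$ is the maximum of $|p(b|a_i,a_j)+p(b|a_i',a_j')-p(b|a_i,a_j')-p(b|a_i',a_j)|$ over all $b\in\mathcal{B}$, $a_i,a_i'\in\mathcal{A}_i$, $a_j,a_j'\in\mathcal{A}_j$, and all two-sender MACs $p(b|a_i,a_j)$ obtained from $\mathbf{p}$ by fixing the inputs of all other senders to arbitrary values. Finally $I_2^{(i,j)}(\rho):=\max\{I_2^{(i,j)}(\mathbf{p}):\mathbf{p}\in\mathcal{Q}_N(\rho)\}$. *)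

theory Defs
  imports "HOL-Analysis.Analysis"
begin

text \<open>
  A single mode is \<open>complex ^ bool\<close>, with \<open>False\<close> the vacuum and \<open>True\<close> one particle. The senders
  are the elements of a finite type \<open>'n\<close>, and the tensor product of their modes is
  \<open>complex ^ ('n \<Rightarrow> bool)\<close>, in coordinates with respect to the product basis, which is indexed by
  the occupation patterns \<open>'n \<Rightarrow> bool\<close>.
\<close>

type_synonym 'x operator = "complex ^ 'x ^ 'x"
type_synonym mode_op = "bool operator"
type_synonym 'n joint_vec = "complex ^ ('n \<Rightarrow> bool)"
type_synonym 'n joint_op = "('n \<Rightarrow> bool) operator"

definition braket :: "complex ^ 'x::finite \<Rightarrow> complex ^ 'x \<Rightarrow> complex" where
  "braket u v = (\<Sum>s\<in>UNIV. cnj (u $ s) * v $ s)"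

definition ketbra :: "complex ^ 'x::finite \<Rightarrow> complex ^ 'x \<Rightarrow> 'x operator" where
  "ketbra u v = (\<chi> s t. u $ s * cnj (v $ t))"

definition dagger :: "'x::finite operator \<Rightarrow> 'x operator" where
  "dagger M = (\<chi> s t. cnj (M $ t $ s))"

definition psd :: "'x::finite operator \<Rightarrow> bool" where
  "psd M \<longleftrightarrow> (\<forall>v. braket v (M *v v) \<in> \<real>\<^sub>\<ge>\<^sub>0)"

text \<open>Powers are defined by hand because \<open>^\<close> on vectors and matrices would be componentwise.\<close>

definition op_power :: "'x::finite operator \<Rightarrow> nat \<Rightarrow> 'x operator" where
  "op_power M k = (((**) M) ^^ k) (mat 1)"

abbreviation ket :: "bool \<Rightarrow> complex ^ bool" where
  "ket s \<equiv> axis s 1"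

definition tensor_vec :: "('n::finite \<Rightarrow> complex ^ bool) \<Rightarrow> 'n joint_vec" where
  "tensor_vec v = (\<chi> s. \<Prod>k\<in>UNIV. v k $ s k)"

definition tensor_op :: "('n::finite \<Rightarrow> mode_op) \<Rightarrow> 'n joint_op" where
  "tensor_op M = (\<chi> s t. \<Prod>k\<in>UNIV. M k $ s k $ t k)"

text \<open>
  The tensor product of linear maps on single-mode operators: the linear extension of
  \<open>\<Otimes>\<^sub>k |s\<^sub>k\<rangle>\<langle>t\<^sub>k| \<mapsto> \<Otimes>\<^sub>k E\<^sub>k(|s\<^sub>k\<rangle>\<langle>t\<^sub>k|)\<close> from the matrix units to all operators.
\<close>

definition tensor_channel ::
    "('n::finite \<Rightarrow> mode_op \<Rightarrow> mode_op) \<Rightarrow> 'n joint_op \<Rightarrow> 'n joint_op" where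
  "tensor_channel E \<rho> = (\<chi> u v. \<Sum>s\<in>UNIV. \<Sum>t\<in>UNIV.
     \<rho> $ s $ t * tensor_op (\<lambda>k. E k (ketbra (ket (s k)) (ket (t k)))) $ u $ v)"

definition one_particle_vec :: "'n::finite \<Rightarrow> 'n joint_vec" where
  "one_particle_vec i = tensor_vec (\<lambda>k. if k = i then ket True else ket False)"

text \<open>\<open>vec.span\<close> is the complex-linear span, unlike \<open>span\<close>, which is real-linear.\<close>

definition one_particle_space :: "'n::finite joint_vec set" where
  "one_particle_space = vec.span (range one_particle_vec)"

definition density_op :: "'x::finite operator \<Rightarrow> bool" where
  "density_op \<rho> \<longleftrightarrow> psd \<rho> \<and> trace \<rho> = 1"

text \<open>
  An operator on the one-particle space is regarded as an operator on all of
  \<open>complex ^ ('n \<Rightarrow> bool)\<close>. A positive semidefinite operator is Hermitian, so requiring its range to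
  lie in the one-particle space also makes it vanish on the orthogonal complement.
\<close>

definition one_particle_density :: "'n::finite joint_op \<Rightarrow> bool" where
  "one_particle_density \<rho> \<longleftrightarrow> density_op \<rho> \<and> (\<forall>v. \<rho> *v v \<in> one_particle_space)"

definition coherence :: "'n::finite joint_op \<Rightarrow> 'n \<Rightarrow> 'n \<Rightarrow> complex" where
  "coherence \<rho> i j = braket (one_particle_vec i) (\<rho> *v one_particle_vec j)"

definition mode_matrix :: "complex \<Rightarrow> complex \<Rightarrow> complex \<Rightarrow> complex \<Rightarrow> mode_op" where
  "mode_matrix m00 m01 m10 m11 =
     (\<chi> r c. if r then (if c then m11 else m10) else (if c then m01 else m00))"

definition npe_kraus :: "complex \<Rightarrow> complex \<Rightarrow> mode_op \<Rightarrow> mode_op" where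
  "npe_kraus y z X =
     mode_matrix 1 0 0 y ** X ** dagger (mode_matrix 1 0 0 y)
     + mode_matrix 0 z 0 0 ** X ** dagger (mode_matrix 0 z 0 0)"

definition npe :: "(mode_op \<Rightarrow> mode_op) \<Rightarrow> bool" where
  "npe E \<longleftrightarrow> (\<exists>(m::nat) (w::nat \<Rightarrow> real) (y::nat \<Rightarrow> complex) (z::nat \<Rightarrow> complex).
     (\<forall>k<m. 0 \<le> w k \<and> (cmod (y k))\<^sup>2 + (cmod (z k))\<^sup>2 = 1) \<and>
     (\<Sum>k<m. w k) = 1 \<and>
     (\<forall>X. E X = (\<Sum>k<m. w k *\<^sub>R npe_kraus (y k) (z k) X)))"

definition povm :: "'b set \<Rightarrow> ('b \<Rightarrow> 'x::finite operator) \<Rightarrow> bool" where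
  "povm B M \<longleftrightarrow> (\<forall>b\<in>B. psd (M b)) \<and> (\<Sum>b\<in>B. M b) = mat 1"

text \<open>
  Sender \<open>k\<close> has input set \<open>A k\<close>. A MAC is a function \<open>p\<close>, with \<open>p b a\<close> the probability of output
  \<open>b\<close> given the joint input \<open>a\<close>; only its values for \<open>b \<in> B\<close> and \<open>a \<in> Pi UNIV A\<close> matter.
\<close>

type_synonym ('n, 'a, 'b) mac = "'b \<Rightarrow> ('n \<Rightarrow> 'a) \<Rightarrow> real"

definition realizes_mac ::
    "('n::finite \<Rightarrow> 'a set) \<Rightarrow> 'b set \<Rightarrow> 'n joint_op \<Rightarrow>
     ('n \<Rightarrow> 'a \<Rightarrow> mode_op \<Rightarrow> mode_op) \<Rightarrow> ('b \<Rightarrow> 'n joint_op) \<Rightarrow> ('n, 'a, 'b) mac \<Rightarrow> bool" where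
  "realizes_mac A B \<rho> E M p \<longleftrightarrow>
     (\<forall>k. \<forall>x\<in>A k. npe (E k x)) \<and> povm B M \<and>
     (\<forall>b\<in>B. \<forall>a\<in>Pi UNIV A.
        complex_of_real (p b a) = trace (M b ** tensor_channel (\<lambda>k. E k (a k)) \<rho>))"

definition quantum_macs ::
    "('n::finite \<Rightarrow> 'a set) \<Rightarrow> 'b set \<Rightarrow> 'n joint_op \<Rightarrow> ('n, 'a, 'b) mac set" where
  "quantum_macs A B \<rho> = {p. \<exists>E M. realizes_mac A B \<rho> E M p}"

text \<open>
  The joint input \<open>a\<close> supplies the fixed inputs of the senders other than \<open>i\<close> and \<open>j\<close>. For finite
  \<open>B\<close> and \<open>A k\<close> the maximum is over a finite set.
\<close>

definition I2_mac ::
    "('n::finite \<Rightarrow> 'a set) \<Rightarrow> 'b set \<Rightarrow> 'n \<Rightarrow> 'n \<Rightarrow> ('n, 'a, 'b) mac \<Rightarrow> real" where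
  "I2_mac A B i j p = Max {\<bar>p b (a(i := x, j := y)) + p b (a(i := x', j := y'))
       - p b (a(i := x, j := y')) - p b (a(i := x', j := y))\<bar> | b a x x' y y'.
       b \<in> B \<and> a \<in> Pi UNIV A \<and> x \<in> A i \<and> x' \<in> A i \<and> y \<in> A j \<and> y' \<in> A j}"

text \<open>
  A maximum over an infinite set, hence \<open>GREATEST\<close> rather than \<open>Max\<close>. The term is meaningful only if
  the maximum exists, which has to be established separately.
\<close>

definition I2_state ::
    "('n::finite \<Rightarrow> 'a set) \<Rightarrow> 'b set \<Rightarrow> 'n \<Rightarrow> 'n \<Rightarrow> 'n joint_op \<Rightarrow> real" where
  "I2_state A B i j \<rho> = (GREATEST v. v \<in> I2_mac A B i j ` quantum_macs A B \<rho>)"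

definition sigma_z :: mode_op where
  "sigma_z = ketbra (ket False) (ket False)
     + ketbra (exp (\<i> * complex_of_real pi) *s ket True) (ket True)"

definition phase_encoding :: "nat \<Rightarrow> mode_op \<Rightarrow> mode_op" where
  "phase_encoding a X = op_power sigma_z a ** X ** op_power sigma_z a"

end

theory Submission
  imports Defs
begin

text \<open>
  An NPE operation fixes \<open>|0\<rangle>\<langle>0|\<close>, keeps \<open>|1\<rangle>\<langle>1|\<close> diagonal and multiplies \<open>|1\<rangle>\<langle>0|\<close> by some \<open>\<eta>\<close>
  with \<open>|\<eta>| \<le> 1\<close>. On the one-particle space, the output contribution of \<open>|e\<^sub>k\<rangle>\<langle>e\<^sub>l|\<close> therefore depends only
  on the inputs of senders \<open>k\<close> and \<open>l\<close>, so the second difference in the inputs of \<open>i\<close> and \<open>j\<close> kills all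
  contributions except those of \<open>|e\<^sub>i\<rangle>\<langle>e\<^sub>j|\<close> and its adjoint. What remains is
  \<open>2 Re (\<rho>\<^sub>i\<^sub>j (\<eta>\<^sub>i - \<eta>\<^sub>i') cnj (\<eta>\<^sub>j - \<eta>\<^sub>j') \<langle>e\<^sub>j|\<Pi>|e\<^sub>i\<rangle>)\<close>, where the differences have modulus at most \<open>2\<close> and
  the off-diagonal entry of \<open>0 \<le> \<Pi> \<le> 1\<close> has modulus at most \<open>1/2\<close>. Equality holds for \<open>\<eta> = \<plusminus>1\<close> and the
  projector \<open>\<Pi>\<close> onto \<open>(|e\<^sub>i\<rangle> + u|e\<^sub>j\<rangle>)/\<surd>2\<close> with a phase \<open>u\<close> making \<open>u \<rho>\<^sub>i\<^sub>j\<close> nonnegative.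
\<close>

section \<open>Operators in coordinates\<close>

text \<open>The conditions are nested, not conjoined, so that the inner sum collapses first and then
  the outer one.\<close>

lemma sum_delta_nested:
  "(\<Sum>s\<in>UNIV. \<Sum>t\<in>UNIV. if s = p then if t = q then f s t else 0 else 0)
    = (f p q :: 'c::comm_monoid_add)" for p q :: "'x::finite"
proof -
  have "(\<Sum>t\<in>UNIV. if s = p then if t = q then f s t else 0 else 0) = (if s = p then f s q else 0)"
    for s
    by simp
  then show ?thesis by simp
qed

lemma braket_axis: "braket (axis s 1) w = w $ s"
  by (simp add: braket_def axis_def if_distrib if_distribR cong: if_cong)

lemma braket_add_left: "braket (u + v) w = braket u w + braket v w"
  by (simp add: braket_def sum.distrib algebra_simps)

lemma braket_scale_left: "braket (c *s u) w = cnj c * braket u w"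
  by (simp add: braket_def sum_distrib_left algebra_simps)

lemma braket_diff_right: "braket u (v - w) = braket u v - braket u w"
  by (simp add: braket_def sum_subtractf algebra_simps)

lemma braket_scale_right: "braket u (c *s v) = c * braket u v"
  by (simp add: braket_def sum_distrib_left algebra_simps)

lemma braket_diff_left: "braket (u - v) w = braket u w - braket v w"
  by (simp add: braket_def sum_subtractf algebra_simps)

lemma cnj_braket: "cnj (braket u v) = braket v u"
  by (simp add: braket_def mult.commute)

lemma matrix_vector_mult_axis_nth: "(M *v axis t 1) $ s = (M :: 'x::finite operator) $ s $ t"
  by (simp add: matrix_vector_mult_def axis_def if_distrib cong: if_cong)

text \<open>Superpositions of two basis vectors are the only test vectors used: they yield
  hermiticity and the bound on off-diagonal entries.\<close>

lemma quadratic_form_axis2: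
  fixes M :: "'x::finite operator"
  shows "braket (axis s 1 + c *s axis t 1) (M *v (axis s 1 + c *s axis t 1))
    = M $ s $ s + c * M $ s $ t + cnj c * M $ t $ s + (cmod c)\<^sup>2 * M $ t $ t"
  unfolding complex_norm_square
  by (simp add: braket_add_left braket_scale_left braket_axis matrix_vector_right_distrib
      vector_scalar_commute matrix_vector_mult_axis_nth algebra_simps)

text \<open>Polarization: the form is real on every test vector. Since diagonal entries are real,
  \<open>c = 1\<close> makes the imaginary parts of the two off-diagonal entries opposite, and
  \<open>c = \<i>\<close> makes their real parts equal.\<close>

lemma psd_hermitian:
  fixes M :: "'x::finite operator"
  assumes "psd M"
  shows "M $ t $ s = cnj (M $ s $ t)"
proof -
  have real: "Im (M $ s $ s + c * M $ s $ t + cnj c * M $ t $ s + (cmod c)\<^sup>2 * M $ t $ t) = 0"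
    for s t c
    using assms unfolding psd_def quadratic_form_axis2[symmetric]
    by (metis complex_nonneg_Reals_iff)
  have diag: "Im (M $ s $ s) = 0" for s
    using real[of s 0 s] by simp
  show ?thesis
    using real[of s 1 t] real[of s \<i> t] diag[of s] diag[of t] by (simp add: complex_eq_iff)
qed

lemma ex_phase: "\<exists>u. cmod u = 1 \<and> u * z = of_real (cmod z)"
proof (cases "z = 0")
  case True
  then show ?thesis by (intro exI[of _ 1]) simp
next
  case False
  have "cnj z / of_real (cmod z) * z = of_real (cmod z)"
    using False by (simp add: field_simps power2_eq_square flip: complex_norm_square)
  then show ?thesis
    using False by (intro exI[of _ "cnj z / of_real (cmod z)"]) (simp add: norm_divide)
qed

lemma trace_matrix_mult:
  fixes M X :: "'x::finite operator"
  shows "trace (M ** X) = (\<Sum>s\<in>UNIV. \<Sum>t\<in>UNIV. M $ s $ t * X $ t $ s)"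
  by (simp add: trace_def matrix_matrix_mult_def)

lemma ketbra_axis_nth:
  "ketbra (c *s axis p 1) (axis q 1) $ s $ t = (if s = p \<and> t = q then c else 0)"
  by (simp add: ketbra_def axis_def)

lemma trace_matrix_mult_ketbra_axis:
  fixes M :: "'x::finite operator"
  shows "trace (M ** ketbra (c *s axis p 1) (axis q 1)) = c * M $ q $ p"
proof -
  have "M $ s $ t * ketbra (c *s axis p 1) (axis q 1) $ t $ s
      = (if s = q then if t = p then c * M $ s $ t else 0 else 0)" for s t
    by (simp add: ketbra_axis_nth)
  then show ?thesis
    by (simp add: trace_matrix_mult sum_delta_nested)
qed

text \<open>Conjugation transposes both factors, which only swaps the two summation indices. Hence
  nothing is lost when probabilities are defined as real parts of traces.\<close>

lemma trace_hermitian_mult_real: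
  fixes M X :: "'x::finite operator"
  assumes "\<And>s t. M $ t $ s = cnj (M $ s $ t)" and "\<And>s t. X $ t $ s = cnj (X $ s $ t)"
  shows "complex_of_real (Re (trace (M ** X))) = trace (M ** X)"
proof -
  have "cnj (trace (M ** X)) = (\<Sum>s\<in>UNIV. \<Sum>t\<in>UNIV. M $ t $ s * X $ s $ t)"
    by (simp add: trace_matrix_mult flip: assms)
  also have "\<dots> = trace (M ** X)"
    unfolding trace_matrix_mult by (rule sum.swap)
  finally show ?thesis
    by (metis Reals_cnj_iff of_real_Re)
qed

lemma ketbra_mult_vec: "ketbra u w *v v = braket w v *s u"
  by (simp add: vec_eq_iff ketbra_def braket_def matrix_vector_mult_def sum_distrib_left
      sum_distrib_right mult_ac)

section \<open>Projectors onto a vector and effects of a POVM\<close>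

lemma psd_ketbra: "psd (ketbra \<psi> \<psi>)"
proof -
  have "braket v (ketbra \<psi> \<psi> *v v) = (cmod (braket \<psi> v))\<^sup>2" for v
    unfolding complex_norm_square by (simp add: ketbra_mult_vec braket_scale_right cnj_braket)
  then show ?thesis
    by (simp add: psd_def)
qed

text \<open>The quadratic form at \<open>v\<close> is the squared norm of the component of
  \<open>v\<close> orthogonal to the unit vector \<open>\<psi>\<close>.\<close>

lemma psd_one_minus_ketbra:
  assumes "braket \<psi> \<psi> = 1"
  shows "psd (mat 1 - ketbra \<psi> \<psi>)"
proof -
  have nonneg: "braket w w \<in> \<real>\<^sub>\<ge>\<^sub>0" for w :: "complex ^ 'a"
    by (simp add: braket_def complex_nonneg_Reals_iff sum_nonneg mult.commute[of "Re _" "Im _"])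
  have "braket v ((mat 1 - ketbra \<psi> \<psi>) *v v)
      = braket (v - braket \<psi> v *s \<psi>) (v - braket \<psi> v *s \<psi>)" for v
  proof -
    have "(mat 1 - ketbra \<psi> \<psi>) *v v = v - braket \<psi> v *s \<psi>"
      by (simp add: matrix_vector_mult_diff_rdistrib ketbra_mult_vec)
    moreover have "braket \<psi> (v - braket \<psi> v *s \<psi>) = 0"
      by (simp add: braket_diff_right braket_scale_right assms)
    ultimately show ?thesis
      by (simp add: braket_diff_left braket_scale_left)
  qed
  then show ?thesis
    by (simp add: psd_def nonneg)
qed

lemma psd_sum:
  fixes M :: "'b \<Rightarrow> 'x::finite operator"
  assumes "\<And>b. b \<in> S \<Longrightarrow> psd (M b)"
  shows "psd (\<Sum>b\<in>S. M b)"
proof -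
  have "braket v ((\<Sum>b\<in>S. M b) *v v) = (\<Sum>b\<in>S. braket v (M b *v v))" for v
  proof (induction S rule: infinite_finite_induct)
    case (insert x F)
    then show ?case
      by (simp add: matrix_vector_mult_add_rdistrib braket_def sum.distrib algebra_simps)
  qed (simp_all add: braket_def)
  then show ?thesis
    using assms by (simp add: psd_def complex_nonneg_Reals_iff sum_nonneg)
qed

text \<open>The complement is the sum of the remaining POVM elements.\<close>

lemma povm_complement_psd:
  assumes "povm B M" "finite B" "b \<in> B"
  shows "psd (mat 1 - M b)"
proof -
  have "mat 1 - M b = (\<Sum>b'\<in>B - {b}. M b')"
    using assms by (simp add: povm_def sum.remove algebra_simps)
  with assms show ?thesis
    by (auto simp: povm_def intro: psd_sum)
qed

text \<open>Compare \<open>M\<close> on \<open>|s\<rangle> + u|t\<rangle>\<close> with \<open>1 - M\<close> on \<open>|s\<rangle> - u|t\<rangle>\<close>: the diagonal entries cancel.\<close>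

lemma effect_off_diagonal_bound:
  fixes M :: "'x::finite operator"
  assumes "psd M" "psd (mat 1 - M)" "s \<noteq> t"
  shows "cmod (M $ s $ t) \<le> 1/2"
proof -
  obtain u where u: "cmod u = 1" "u * M $ s $ t = of_real (cmod (M $ s $ t))"
    using ex_phase by blast
  have herm: "M $ t $ s = cnj (M $ s $ t)"
    using assms(1) by (rule psd_hermitian)
  have ge: "0 \<le> Re (N $ s $ s + c * N $ s $ t + cnj c * N $ t $ s + (cmod c)\<^sup>2 * N $ t $ t)"
    if "psd N" for N :: "'x operator" and c
    using that unfolding psd_def quadratic_form_axis2[symmetric]
    by (metis complex_nonneg_Reals_iff)
  \<comment> \<open>The phase turns both cross terms onto the nonnegative axis; adding the two
    inequalities below leaves \<open>4 * cmod (M $ s $ t) \<le> 2\<close>.\<close>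
  have 1: "Re (u * M $ s $ t) = cmod (M $ s $ t)" "Re (cnj u * M $ t $ s) = cmod (M $ s $ t)"
    using arg_cong[OF u(2), of Re] by (simp_all add: herm)
  have "0 \<le> Re (M $ s $ s) - 2 * cmod (M $ s $ t) + Re (M $ t $ t)"
    using ge[OF assms(1), of "- u"] 1 u(1) by simp
  moreover have "0 \<le> 1 - Re (M $ s $ s) - 2 * cmod (M $ s $ t) + (1 - Re (M $ t $ t))"
    using ge[OF assms(2), of u] 1 u(1) assms(3) by (simp add: mat_def)
  ultimately show ?thesis by simp
qed

section \<open>NPE operations\<close>

lemma mode_op_eqI:
  fixes X Y :: mode_op
  assumes "X $ False $ False = Y $ False $ False" "X $ False $ True = Y $ False $ True"
    "X $ True $ False = Y $ True $ False" "X $ True $ True = Y $ True $ True"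
  shows "X = Y"
proof -
  have "X $ r $ c = Y $ r $ c" for r c
    using assms by (cases r; cases c) simp_all
  then show ?thesis by (simp add: vec_eq_iff)
qed

lemma mode_matrix_nth [simp]:
  "mode_matrix a b c d $ False $ False = a" "mode_matrix a b c d $ False $ True = b"
  "mode_matrix a b c d $ True $ False = c" "mode_matrix a b c d $ True $ True = d"
  by (simp_all add: mode_matrix_def)

text \<open>Amplitude damping: \<open>z\<close> moves population from the particle to the vacuum,
  \<open>y\<close> scales the coherences.\<close>

lemma npe_kraus_eq:
  "npe_kraus y z X = mode_matrix
    (X $ False $ False + (cmod z)\<^sup>2 * X $ True $ True) (cnj y * X $ False $ True)
    (y * X $ True $ False) ((cmod y)\<^sup>2 * X $ True $ True)"
  unfolding complex_norm_square
  by (rule mode_op_eqI)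
    (simp_all add: npe_kraus_def matrix_matrix_mult_def dagger_def UNIV_bool)

text \<open>The matrix of a channel with respect to matrix units: \<open>s\<close>, \<open>t\<close>
  label the input and \<open>u\<close>, \<open>v\<close> the output.\<close>

definition channel_entry :: "(mode_op \<Rightarrow> mode_op) \<Rightarrow> bool \<Rightarrow> bool \<Rightarrow> bool \<Rightarrow> bool \<Rightarrow> complex" where
  "channel_entry E s t u v = E (ketbra (ket s) (ket t)) $ u $ v"

text \<open>This is the factor \<eta>, the only feature of an NPE operation that survives in a
  second difference.\<close>

definition damping :: "(mode_op \<Rightarrow> mode_op) \<Rightarrow> complex" where
  "damping E = channel_entry E True False True False"

text \<open>Each claim is read off from a single Kraus pair and carried through the convex
  combination; the damping becomes the weighted mean of the \<open>y k\<close>, all of modulus at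
  most 1.\<close>

lemma npe_channel_entry:
  assumes "npe E"
  shows "channel_entry E False False u v = (if \<not> u \<and> \<not> v then 1 else 0)"
    and "channel_entry E True False u v = (if u \<and> \<not> v then damping E else 0)"
    and "channel_entry E False True u v = (if \<not> u \<and> v then cnj (damping E) else 0)"
    and "cmod (damping E) \<le> 1"
    and "channel_entry E t s v u = cnj (channel_entry E s t u v)"
proof -
  obtain m and w :: "nat \<Rightarrow> real" and y z :: "nat \<Rightarrow> complex" where
    nonneg: "\<And>k. k < m \<Longrightarrow> 0 \<le> w k"
    and unit: "\<And>k. k < m \<Longrightarrow> (cmod (y k))\<^sup>2 + (cmod (z k))\<^sup>2 = 1"
    and total: "(\<Sum>k<m. w k) = 1"
    and E: "\<And>X. E X = (\<Sum>k<m. w k *\<^sub>R npe_kraus (y k) (z k) X)"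
    using assms unfolding npe_def by blast
  have total': "(\<Sum>k<m. complex_of_real (w k)) = 1"
    using total by (simp flip: of_real_sum)
  have entry: "channel_entry E s t u v
      = (\<Sum>k<m. w k * npe_kraus (y k) (z k) (ketbra (ket s) (ket t)) $ u $ v)" for s t u v
    by (simp add: channel_entry_def E) (simp add: scaleR_conv_of_real)
  have damping: "damping E = (\<Sum>k<m. w k * y k)"
    by (simp add: damping_def entry npe_kraus_eq ketbra_def axis_def)
  show "channel_entry E False False u v = (if \<not> u \<and> \<not> v then 1 else 0)"
    using total' by (cases u; cases v) (simp_all add: entry npe_kraus_eq ketbra_def axis_def)
  show "channel_entry E True False u v = (if u \<and> \<not> v then damping E else 0)"
    by (cases u; cases v) (simp_all add: damping entry npe_kraus_eq ketbra_def axis_def)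
  show "channel_entry E False True u v = (if \<not> u \<and> v then cnj (damping E) else 0)"
    by (cases u; cases v) (simp_all add: damping entry npe_kraus_eq ketbra_def axis_def)
  have "cmod (y k) \<le> 1" if "k < m" for k
    using unit[OF that] by (smt (verit) one_less_power pos2 zero_le_power2)
  then have "cmod (damping E) \<le> (\<Sum>k<m. w k * 1)"
    unfolding damping
    by (intro sum_norm_le) (simp add: norm_mult nonneg mult_left_le)
  then show "cmod (damping E) \<le> 1"
    using total by simp
  have "npe_kraus y z (ketbra (ket t) (ket s)) $ v $ u
      = cnj (npe_kraus y z (ketbra (ket s) (ket t)) $ u $ v)" for y z
    by (cases s; cases t; cases u; cases v) (simp_all add: npe_kraus_eq ketbra_def axis_def)
  then show "channel_entry E t s v u = cnj (channel_entry E s t u v)"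
    by (simp add: entry)
qed

lemma npe_single: "cmod y = 1 \<Longrightarrow> npe (npe_kraus y 0)"
  unfolding npe_def
  by (intro exI[of _ 1] exI[of _ "\<lambda>_. 1"] exI[of _ "\<lambda>_. y"] exI[of _ "\<lambda>_. 0"]) simp

lemma damping_npe_kraus: "damping (npe_kraus y z) = y"
  by (simp add: damping_def channel_entry_def npe_kraus_eq ketbra_def axis_def)

lemma op_power_sigma_z: "op_power sigma_z n = mode_matrix 1 0 0 ((-1) ^ n)"
proof (induction n)
  case 0
  show ?case
    by (rule mode_op_eqI) (simp_all add: op_power_def mat_def)
next
  case (Suc n)
  then have "op_power sigma_z (Suc n) = sigma_z ** mode_matrix 1 0 0 ((-1) ^ n)"
    by (simp add: op_power_def)
  also have "\<dots> = mode_matrix 1 0 0 ((-1) ^ Suc n)"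
    by (rule mode_op_eqI)
      (simp_all add: matrix_matrix_mult_def UNIV_bool sigma_z_def ketbra_def axis_def)
  finally show ?case .
qed

text \<open>Powers of \<open>sigma_z\<close> are real and diagonal, hence self-adjoint, so this is a
  lossless Kraus pair with damping \<plusminus>1.\<close>

lemma phase_encoding_eq: "phase_encoding n = npe_kraus ((-1) ^ n) 0"
  by (rule ext, rule mode_op_eqI)
    (simp_all add: phase_encoding_def op_power_sigma_z npe_kraus_eq matrix_matrix_mult_def
      UNIV_bool norm_power flip: power_mult_distrib)

section \<open>The one-particle sector\<close>

definition occ :: "'n \<Rightarrow> 'n \<Rightarrow> bool" where
  "occ i = (\<lambda>k. k = i)"

lemma occ_eq_iff [simp]: "occ i = occ j \<longleftrightarrow> i = j"
  by (auto simp: occ_def fun_eq_iff)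

text \<open>The modes are split into \<open>i\<close>, \<open>j\<close> and the rest to match the
  factorization in \<open>second_difference_prod\<close>.\<close>

lemma eq_occ_iff:
  assumes "i \<noteq> j"
  shows "u = occ i \<longleftrightarrow> u i \<and> \<not> u j \<and> (\<forall>k\<in>UNIV - {i, j}. \<not> u k)"
    and "u = occ j \<longleftrightarrow> \<not> u i \<and> u j \<and> (\<forall>k\<in>UNIV - {i, j}. \<not> u k)"
proof -
  show "u = occ i \<longleftrightarrow> u i \<and> \<not> u j \<and> (\<forall>k\<in>UNIV - {i, j}. \<not> u k)"
    unfolding fun_eq_iff occ_def using assms by (metis DiffI UNIV_I Diff_iff empty_iff insert_iff)
  show "u = occ j \<longleftrightarrow> \<not> u i \<and> u j \<and> (\<forall>k\<in>UNIV - {i, j}. \<not> u k)"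
    unfolding fun_eq_iff occ_def using assms by (metis DiffI UNIV_I Diff_iff empty_iff insert_iff)
qed

lemma one_particle_vec_eq: "one_particle_vec i = axis (occ i) 1"
proof -
  have "(\<Prod>k\<in>UNIV. (if k = i then ket True else ket False) $ s k) = (if s = occ i then 1 else 0)"
    for s
  proof (cases "s = occ i")
    case True
    then show ?thesis by (auto simp: occ_def axis_def intro!: prod.neutral)
  next
    case False
    then obtain k where "s k \<noteq> (k = i)" by (auto simp: occ_def fun_eq_iff)
    then have "(if k = i then ket True else ket False) $ s k = 0" by (auto simp: axis_def)
    then have "(\<Prod>k\<in>UNIV. (if k = i then ket True else ket False) $ s k) = 0"
      by (intro prod_zero finite bexI[of _ k] UNIV_I)
    with False show ?thesis by simp
  qed
  then show ?thesis
    by (auto simp: one_particle_vec_def tensor_vec_def vec_eq_iff axis_def)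
qed

lemma coherence_eq: "coherence \<rho> i j = \<rho> $ occ i $ occ j"
  by (simp add: coherence_def one_particle_vec_eq braket_axis matrix_vector_mult_axis_nth)

lemma one_particle_space_nth:
  assumes "v \<in> one_particle_space" "s \<notin> range occ"
  shows "v $ s = 0"
  using assms(1) unfolding one_particle_space_def
proof (induction rule: vec.span_induct_alt)
  case base
  show ?case by simp
next
  case (step c x y)
  with assms(2) show ?case by (auto simp: one_particle_vec_eq axis_def split: if_splits)
qed

text \<open>The range condition kills the rows outside the one-particle patterns; hermiticity
  transfers this to the columns.\<close>

lemma one_particle_density_nth:
  assumes "one_particle_density \<rho>" "s \<notin> range occ \<or> t \<notin> range occ"
  shows "\<rho> $ s $ t = 0"
proof -
  have row: "\<rho> $ s $ t = 0" if "s \<notin> range occ" for s t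
    using assms(1) one_particle_space_nth[OF _ that] matrix_vector_mult_axis_nth[of \<rho> t s]
    by (auto simp: one_particle_density_def)
  have "\<rho> $ s $ t = cnj (\<rho> $ t $ s)"
    using assms(1) by (intro psd_hermitian) (simp add: one_particle_density_def density_op_def)
  with assms(2) row show ?thesis by auto
qed

lemma tensor_channel_nth:
  "tensor_channel E \<rho> $ u $ v
    = (\<Sum>s\<in>UNIV. \<Sum>t\<in>UNIV. \<rho> $ s $ t * (\<Prod>k\<in>UNIV. channel_entry (E k) (s k) (t k) (u k) (v k)))"
  by (simp add: tensor_channel_def tensor_op_def channel_entry_def)

section \<open>Mixed second differences of products and of channel outputs\<close>

text \<open>The codomain is any abelian group, so the same notion serves probabilities, matrix
  entries and operators.\<close>

definition second_difference ::
    "'n \<Rightarrow> 'n \<Rightarrow> (('n \<Rightarrow> 'a) \<Rightarrow> 'c::ab_group_add) \<Rightarrow> ('n \<Rightarrow> 'a) \<Rightarrow> 'a \<Rightarrow> 'a \<Rightarrow> 'a \<Rightarrow> 'a \<Rightarrow> 'c" where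
  "second_difference i j f a x x' y y' = f (a(i := x, j := y)) + f (a(i := x', j := y'))
     - f (a(i := x, j := y')) - f (a(i := x', j := y))"

text \<open>Only two factors see the varied inputs, so the mixed difference splits into a difference
  for each. It vanishes as soon as one of them ignores its input, which is what isolates the
  coherence between \<open>i\<close> and \<open>j\<close>.\<close>

lemma second_difference_prod:
  fixes f :: "'n::finite \<Rightarrow> 'a \<Rightarrow> 'c::comm_ring_1"
  assumes "i \<noteq> j"
  shows "second_difference i j (\<lambda>a. \<Prod>k\<in>UNIV. f k (a k)) a x x' y y'
    = (f i x - f i x') * (f j y - f j y') * (\<Prod>k\<in>UNIV - {i, j}. f k (a k))"
proof -
  have "(\<Prod>k\<in>UNIV. f k ((a(i := x, j := y)) k)) = f i x * f j y * (\<Prod>k\<in>UNIV - {i, j}. f k (a k))"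
    for x y
  proof -
    have "(\<Prod>k\<in>UNIV. f k ((a(i := x, j := y)) k))
        = (\<Prod>k\<in>UNIV - {i, j}. f k ((a(i := x, j := y)) k)) * (\<Prod>k\<in>{i, j}. f k ((a(i := x, j := y)) k))"
      by (rule prod.subset_diff) auto
    also have "(\<Prod>k\<in>UNIV - {i, j}. f k ((a(i := x, j := y)) k)) = (\<Prod>k\<in>UNIV - {i, j}. f k (a k))"
      by (rule prod.cong) auto
    finally show ?thesis
      using assms by (simp add: mult_ac fun_upd_def del: fun_upd_apply)
  qed
  then show ?thesis
    by (simp add: second_difference_def algebra_simps del: fun_upd_apply)
qed

text \<open>Expand \<open>\<rho>\<close> in one-particle matrix units. If mode \<open>i\<close> or
  mode \<open>j\<close> is empty in both ket and bra, the vacuum is preserved for either input and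
  the difference vanishes. In the two remaining terms every other mode is in the vacuum and
  contributes a factor 1 or 0.\<close>

lemma second_difference_tensor_channel:
  fixes E :: "'n::finite \<Rightarrow> 'a \<Rightarrow> mode_op \<Rightarrow> mode_op"
  assumes \<rho>: "one_particle_density \<rho>" and "i \<noteq> j"
    and E: "\<And>k. npe (E k (a k))" "npe (E i x)" "npe (E i x')" "npe (E j y)" "npe (E j y')"
  defines "\<delta> \<equiv> damping (E i x) - damping (E i x')" and "\<epsilon> \<equiv> damping (E j y) - damping (E j y')"
  shows "second_difference i j (\<lambda>a. tensor_channel (\<lambda>k. E k (a k)) \<rho>) a x x' y y'
    = ketbra ((\<rho> $ occ i $ occ j * \<delta> * cnj \<epsilon>) *s axis (occ i) 1) (axis (occ j) 1)
    + ketbra ((\<rho> $ occ j $ occ i * cnj \<delta> * \<epsilon>) *s axis (occ j) 1) (axis (occ i) 1)"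
    (is "?D = ?K")
proof -
  define G where "G s t u v = second_difference i j
    (\<lambda>a. \<Prod>k\<in>UNIV. channel_entry (E k (a k)) (s k) (t k) (u k) (v k)) a x x' y y'" for s t u v
  have G: "G s t u v = (channel_entry (E i x) (s i) (t i) (u i) (v i)
        - channel_entry (E i x') (s i) (t i) (u i) (v i))
      * (channel_entry (E j y) (s j) (t j) (u j) (v j)
        - channel_entry (E j y') (s j) (t j) (u j) (v j))
      * (\<Prod>k\<in>UNIV - {i, j}. channel_entry (E k (a k)) (s k) (t k) (u k) (v k))" for s t u v
    unfolding G_def
    by (rule second_difference_prod[OF \<open>i \<noteq> j\<close>, of "\<lambda>k x. channel_entry (E k x) (s k) (t k) (u k) (v k)"])
  have vacuum: "(\<Prod>k\<in>UNIV - {i, j}. channel_entry (E k (a k)) False False (u k) (v k))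
      = (if \<forall>k\<in>UNIV - {i, j}. \<not> u k \<and> \<not> v k then 1 else 0)" for u v
    by (simp add: npe_channel_entry(1)[OF E(1)])
  define K where "K u v = (if u = occ i \<and> v = occ j then \<delta> * cnj \<epsilon> else 0)" for u v
  define K' where "K' u v = (if u = occ j \<and> v = occ i then cnj \<delta> * \<epsilon> else 0)" for u v
  have summand: "\<rho> $ s $ t * G s t u v = (if s = occ i then if t = occ j then \<rho> $ s $ t * K u v else 0 else 0)
      + (if s = occ j then if t = occ i then \<rho> $ s $ t * K' u v else 0 else 0)" for s t u v
  proof (cases "s \<in> range occ \<and> t \<in> range occ")
    case False
    then have "\<rho> $ s $ t = 0"
      by (intro one_particle_density_nth[OF \<rho>]) simp
    then show ?thesis by (simp only: mult_zero_left if_cancel add_0_left)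
  next
    case True
    then obtain m n where st: "s = occ m" "t = occ n"
      by (elim conjE rangeE)
    consider (ij) "m = i" "n = j" | (ji) "m = j" "n = i"
      | (other) "\<not> (m = i \<and> n = j)" "\<not> (m = j \<and> n = i)"
      by blast
    then show ?thesis
    proof cases
      case ij
      have "(\<Prod>k\<in>UNIV - {i, j}. channel_entry (E k (a k)) (s k) (t k) (u k) (v k))
          = (\<Prod>k\<in>UNIV - {i, j}. channel_entry (E k (a k)) False False (u k) (v k))"
        by (rule prod.cong) (auto simp: st ij occ_def)
      \<comment> \<open>The mode-by-mode constraints on the output labels single out exactly one
        matrix unit.\<close>
      moreover have "u = occ i \<and> v = occ j \<longleftrightarrow> (u i \<and> \<not> v i) \<and> (\<not> u j \<and> v j) \<and>
          (\<forall>k\<in>UNIV - {i, j}. \<not> u k \<and> \<not> v k)"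
        unfolding eq_occ_iff[OF \<open>i \<noteq> j\<close>] by blast
      moreover have "s i" "\<not> s j" "\<not> t i" "t j"
        using \<open>i \<noteq> j\<close> by (auto simp: st ij occ_def)
      ultimately have "G s t u v = K u v"
        by (simp add: G K_def vacuum npe_channel_entry(2,3) E \<delta>_def \<epsilon>_def)
      then show ?thesis
        using \<open>i \<noteq> j\<close> by (simp add: st ij)
    next
      case ji
      have "(\<Prod>k\<in>UNIV - {i, j}. channel_entry (E k (a k)) (s k) (t k) (u k) (v k))
          = (\<Prod>k\<in>UNIV - {i, j}. channel_entry (E k (a k)) False False (u k) (v k))"
        by (rule prod.cong) (auto simp: st ji occ_def)
      moreover have "u = occ j \<and> v = occ i \<longleftrightarrow> (\<not> u i \<and> v i) \<and> (u j \<and> \<not> v j) \<and>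
          (\<forall>k\<in>UNIV - {i, j}. \<not> u k \<and> \<not> v k)"
        unfolding eq_occ_iff[OF \<open>i \<noteq> j\<close>] by blast
      moreover have "\<not> s i" "s j" "t i" "\<not> t j"
        using \<open>i \<noteq> j\<close> by (auto simp: st ji occ_def)
      ultimately have "G s t u v = K' u v"
        by (simp add: G K'_def vacuum npe_channel_entry(2,3) E \<delta>_def \<epsilon>_def)
      then show ?thesis
        using \<open>i \<noteq> j\<close> by (simp add: st ji)
    next
      case other
      \<comment> \<open>Ket and bra hold one particle each, so together they reach both
        \<open>i\<close> and \<open>j\<close> only in the two excluded cases.\<close>
      then consider "\<not> s i" "\<not> t i" | "\<not> s j" "\<not> t j"
        using \<open>i \<noteq> j\<close> by (auto simp: st occ_def)
      then have "G s t u v = 0"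
        by cases (simp_all add: G npe_channel_entry(1) E)
      then show ?thesis
        using other by (auto simp: st)
    qed
  qed
  have "(\<Sum>s\<in>UNIV. \<Sum>t\<in>UNIV. \<rho> $ s $ t * G s t u v)
      = \<rho> $ occ i $ occ j * K u v + \<rho> $ occ j $ occ i * K' u v" for u v
    by (simp only: summand sum.distrib sum_delta_nested)
  moreover have "?K $ u $ v = \<rho> $ occ i $ occ j * K u v + \<rho> $ occ j $ occ i * K' u v" for u v
    by (simp only: K_def K'_def ketbra_axis_nth vector_add_component mult.assoc
        if_distrib[of "(*) c" for c] mult_zero_right)
  moreover have "?D $ u $ v = (\<Sum>s\<in>UNIV. \<Sum>t\<in>UNIV. \<rho> $ s $ t * G s t u v)" for u v
    by (simp add: G_def second_difference_def tensor_channel_nth sum.distrib sum_subtractf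
        distrib_left right_diff_distrib del: fun_upd_apply)
  ultimately show ?thesis
    by (simp add: vec_eq_iff)
qed

section \<open>The value of the second difference\<close>

lemma realizes_mac_second_difference:
  fixes A :: "'n::finite \<Rightarrow> 'a set" and B :: "'b set"
  assumes \<rho>: "one_particle_density \<rho>" and "i \<noteq> j" and p: "realizes_mac A B \<rho> E M p"
    and mem: "b \<in> B" "a \<in> Pi UNIV A" "x \<in> A i" "x' \<in> A i" "y \<in> A j" "y' \<in> A j"
  shows "second_difference i j (p b) a x x' y y'
    = 2 * Re (coherence \<rho> i j * (damping (E i x) - damping (E i x'))
        * cnj (damping (E j y) - damping (E j y')) * M b $ occ j $ occ i)"
    (is "_ = 2 * Re ?z")
proof -
  let ?R = "\<lambda>a. tensor_channel (\<lambda>k. E k (a k)) \<rho>"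
  have npe: "npe (E k x)" if "x \<in> A k" for k x
    using p that by (simp add: realizes_mac_def)
  have p_eq: "complex_of_real (p b a') = trace (M b ** ?R a')" if "a' \<in> Pi UNIV A" for a'
    using p that \<open>b \<in> B\<close> by (simp add: realizes_mac_def)
  have herm: "\<rho> $ occ j $ occ i = cnj (\<rho> $ occ i $ occ j)"
    "M b $ occ i $ occ j = cnj (M b $ occ j $ occ i)"
    using \<rho> p \<open>b \<in> B\<close>
    by (auto simp: one_particle_density_def density_op_def realizes_mac_def povm_def
        intro!: psd_hermitian)
  have upd: "a(i := r, j := s) \<in> Pi UNIV A" if "r \<in> A i" "s \<in> A j" for r s
    using mem(2) that by (auto simp: Pi_iff)
  have "complex_of_real (second_difference i j (p b) a x x' y y')
      = second_difference i j (\<lambda>a. trace (M b ** ?R a)) a x x' y y'"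
    unfolding second_difference_def of_real_add of_real_diff
    using mem upd by (simp add: p_eq del: fun_upd_apply)
  also have "\<dots> = trace (M b ** second_difference i j ?R a x x' y y')"
    by (simp add: second_difference_def trace_matrix_mult distrib_left right_diff_distrib
        sum.distrib sum_subtractf del: fun_upd_apply)
  \<comment> \<open>The two surviving terms are conjugate because \<open>\<rho>\<close> and
    \<open>M b\<close> are Hermitian.\<close>
  also have "\<dots> = ?z + cnj ?z"
    using mem npe
    by (subst second_difference_tensor_channel[OF \<rho> \<open>i \<noteq> j\<close>])
      (auto simp: Pi_iff matrix_add_ldistrib trace_add trace_matrix_mult_ketbra_axis coherence_eq herm)
  also have "\<dots> = complex_of_real (2 * Re ?z)"
    by (rule complex_add_cnj)
  finally show ?thesis
    by (simp only: of_real_eq_iff)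
qed

lemma second_difference_bound:
  fixes A :: "'n::finite \<Rightarrow> 'a set" and B :: "'b set"
  assumes \<rho>: "one_particle_density \<rho>" and "i \<noteq> j" and p: "realizes_mac A B \<rho> E M p"
    and "finite B"
    and mem: "b \<in> B" "a \<in> Pi UNIV A" "x \<in> A i" "x' \<in> A i" "y \<in> A j" "y' \<in> A j"
  shows "\<bar>second_difference i j (p b) a x x' y y'\<bar> \<le> 4 * cmod (coherence \<rho> i j)"
proof -
  define \<delta> \<epsilon> where "\<delta> = damping (E i x) - damping (E i x')"
    and "\<epsilon> = damping (E j y) - damping (E j y')"
  have "cmod (damping (E k x)) \<le> 1" if "x \<in> A k" for k x
    using p that by (intro npe_channel_entry(4)) (simp add: realizes_mac_def)
  \<comment> \<open>The form \<open>1 + 1\<close> is what \<open>add_mono\<close> produces from the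
    triangle inequality.\<close>
  then have \<delta>: "cmod \<delta> \<le> 1 + 1" and \<epsilon>: "cmod \<epsilon> \<le> 1 + 1"
    unfolding \<delta>_def \<epsilon>_def using mem
    by (intro order.trans[OF norm_triangle_ineq4] add_mono; simp)+
  have "povm B M"
    using p by (simp add: realizes_mac_def)
  then have M: "cmod (M b $ occ j $ occ i) \<le> 1/2"
    using \<open>i \<noteq> j\<close> \<open>b \<in> B\<close> povm_complement_psd[OF _ \<open>finite B\<close> \<open>b \<in> B\<close>]
    by (intro effect_off_diagonal_bound) (auto simp: povm_def)
  have "\<bar>second_difference i j (p b) a x x' y y'\<bar>
      = 2 * \<bar>Re (coherence \<rho> i j * \<delta> * cnj \<epsilon> * M b $ occ j $ occ i)\<bar>"
    unfolding realizes_mac_second_difference[OF \<rho> \<open>i \<noteq> j\<close> p mem] \<delta>_def \<epsilon>_def abs_mult by simp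
  also have "\<dots> \<le> 2 * (cmod (coherence \<rho> i j) * (cmod \<delta> * cmod \<epsilon> * cmod (M b $ occ j $ occ i)))"
    using abs_Re_le_cmod[of "coherence \<rho> i j * \<delta> * cnj \<epsilon> * M b $ occ j $ occ i"]
    by (simp add: norm_mult mult_ac)
  also have "\<dots> \<le> 2 * (cmod (coherence \<rho> i j) * ((1 + 1) * (1 + 1) * (1/2)))"
    using \<delta> \<epsilon> M by (intro mult_left_mono mult_mono) auto
  finally show ?thesis by simp
qed

section \<open>From single second differences to their maximum\<close>

abbreviation second_difference_values ::
    "('n::finite \<Rightarrow> 'a set) \<Rightarrow> 'b set \<Rightarrow> 'n \<Rightarrow> 'n \<Rightarrow> ('n, 'a, 'b) mac \<Rightarrow> real set" where
  "second_difference_values A B i j p \<equiv> {\<bar>second_difference i j (p b) a x x' y y'\<bar> | b a x x' y y'.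
     b \<in> B \<and> a \<in> Pi UNIV A \<and> x \<in> A i \<and> x' \<in> A i \<and> y \<in> A j \<and> y' \<in> A j}"

lemma I2_mac_eq: "I2_mac A B i j p = Max (second_difference_values A B i j p)"
  by (simp only: I2_mac_def second_difference_def)

lemma finite_second_difference_values:
  fixes A :: "'n::finite \<Rightarrow> 'a set"
  assumes "\<And>k. finite (A k)" "finite B"
  shows "finite (second_difference_values A B i j p)"
proof -
  \<comment> \<open>No argument lies outside \<open>UNIV\<close>, so extensional and plain products
    coincide.\<close>
  have "finite (Pi UNIV A)"
    using finite_PiE[of UNIV A] assms(1) by (simp add: PiE_def)
  then have "finite (B \<times> Pi UNIV A \<times> A i \<times> A i \<times> A j \<times> A j)"
    using assms by simp
  then show ?thesis
    by (rule finite_surj[where f = "\<lambda>(b, a, x, x', y, y'). \<bar>second_difference i j (p b) a x x' y y'\<bar>"])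
      force
qed

lemma I2_mac_le:
  fixes A :: "'n::finite \<Rightarrow> 'a set"
  assumes fin: "\<And>k. finite (A k)" "finite B" and "B \<noteq> {}" "\<And>k. A k \<noteq> {}"
    and "one_particle_density \<rho>" "i \<noteq> j" "p \<in> quantum_macs A B \<rho>"
  shows "I2_mac A B i j p \<le> 4 * cmod (coherence \<rho> i j)"
proof -
  obtain b where "b \<in> B"
    using \<open>B \<noteq> {}\<close> by blast
  obtain a where "\<And>k. a k \<in> A k"
    using \<open>\<And>k. A k \<noteq> {}\<close> that[of "\<lambda>k. SOME x. x \<in> A k"] by (simp add: some_in_eq)
  \<comment> \<open>Equal inputs give the value 0, which suffices to make the set under
    \<open>Max\<close> nonempty.\<close>
  with \<open>b \<in> B\<close> have "\<bar>second_difference i j (p b) a (a i) (a i) (a j) (a j)\<bar> \<in> second_difference_values A B i j p"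
    by blast
  moreover obtain E M where "realizes_mac A B \<rho> E M p"
    using assms(7) by (auto simp: quantum_macs_def)
  ultimately show ?thesis
    unfolding I2_mac_eq using assms second_difference_bound[of \<rho> i j A B E M p]
    by (intro Max.boundedI finite_second_difference_values) blast+
qed

section \<open>Attaining the bound by a phase encoding\<close>

text \<open>Each factor preserves hermiticity, so conjugation just exchanges the two input patterns
  being summed over.\<close>

lemma tensor_channel_hermitian:
  assumes "\<And>k. npe (E k)" "\<And>s t. \<rho> $ t $ s = cnj (\<rho> $ s $ t)"
  shows "tensor_channel E \<rho> $ v $ u = cnj (tensor_channel E \<rho> $ u $ v)"
proof -
  have "cnj (tensor_channel E \<rho> $ u $ v) = (\<Sum>s\<in>UNIV. \<Sum>t\<in>UNIV.
      \<rho> $ t $ s * (\<Prod>k\<in>UNIV. channel_entry (E k) (t k) (s k) (v k) (u k)))"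
    by (simp add: tensor_channel_nth flip: assms(2) npe_channel_entry(5)[OF assms(1)])
  also have "\<dots> = tensor_channel E \<rho> $ v $ u"
    unfolding tensor_channel_nth by (rule sum.swap)
  finally show ?thesis ..
qed

lemma realizes_mac_Re_trace:
  assumes "one_particle_density \<rho>" "povm B M" "\<And>k x. npe (E k x)"
  shows "realizes_mac A B \<rho> E M (\<lambda>b a. Re (trace (M b ** tensor_channel (\<lambda>k. E k (a k)) \<rho>)))"
proof -
  have "\<rho> $ t $ s = cnj (\<rho> $ s $ t)" for s t
    using assms(1) by (intro psd_hermitian) (simp add: one_particle_density_def density_op_def)
  moreover have "M b $ t $ s = cnj (M b $ s $ t)" if "b \<in> B" for b s t
    using assms(2) that by (intro psd_hermitian) (simp add: povm_def)
  ultimately show ?thesis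
    using assms(2,3) unfolding realizes_mac_def
    by (blast intro: trace_hermitian_mult_real tensor_channel_hermitian)
qed

text \<open>Outputs beyond the two chosen ones get the zero operator, so \<open>B\<close> may be
  larger.\<close>

lemma povm_two_outcomes:
  assumes "psd P" "psd (mat 1 - P)" "finite B" "b\<^sub>0 \<in> B" "b\<^sub>1 \<in> B" "b\<^sub>0 \<noteq> b\<^sub>1"
  shows "povm B (\<lambda>b. if b = b\<^sub>0 then P else if b = b\<^sub>1 then mat 1 - P else 0)" (is "povm B ?M")
proof -
  have "psd (0 :: 'x::finite operator)"
    using psd_sum[of "{}" "\<lambda>_. 0"] by simp
  moreover have "(\<Sum>b\<in>B. ?M b) = (\<Sum>b\<in>{b\<^sub>0, b\<^sub>1}. ?M b)"
    using assms by (intro sum.mono_neutral_right) auto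
  ultimately show ?thesis
    using assms by (auto simp: povm_def)
qed

text \<open>Input sets are arbitrary, so \<open>c\<close> and \<open>d\<close> translate inputs into
  bits; surjectivity ensures that both phases occur.\<close>

lemma phase_encoding_attains:
  fixes A :: "'n::finite \<Rightarrow> 'a set" and c d :: "'a \<Rightarrow> nat"
  assumes fin: "\<And>k. finite (A k)" "finite B" and B: "card B \<ge> 2" and ne: "\<And>k. A k \<noteq> {}"
    and \<rho>: "one_particle_density \<rho>" and "i \<noteq> j"
    and c: "c ` A i = {0, 1}" and d: "d ` A j = {0, 1}"
  shows "\<exists>E M p. realizes_mac A B \<rho> E M p
    \<and> (\<forall>x\<in>A i. E i x = phase_encoding (c x)) \<and> (\<forall>y\<in>A j. E j y = phase_encoding (d y))
    \<and> I2_mac A B i j p = 4 * cmod (coherence \<rho> i j)"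
proof -
  obtain u where u: "cmod u = 1" "u * coherence \<rho> i j = cmod (coherence \<rho> i j)"
    using ex_phase by blast
  define r where "r = complex_of_real (1 / sqrt 2)"
  have r: "cnj r = r" "r * r = 1/2"
    by (simp_all add: r_def flip: of_real_mult)
  \<comment> \<open>The projector onto this vector has entry \<open>u / 2\<close> at
    \<open>occ j\<close>, \<open>occ i\<close>: the largest possible modulus, with the phase that
    cancels that of the coherence.\<close>
  define \<psi> :: "'n joint_vec" where "\<psi> = r *s axis (occ i) 1 + (u * r) *s axis (occ j) 1"
  have \<psi>_nth: "\<psi> $ occ i = r" "\<psi> $ occ j = u * r"
    using \<open>i \<noteq> j\<close> by (simp_all add: \<psi>_def axis_def)
  have "cnj u * u = 1"
    using u(1) complex_norm_square[of u] by (simp add: mult.commute)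
  then have "braket \<psi> \<psi> = r * r + r * r"
    by (subst (1) \<psi>_def) (simp add: braket_add_left braket_scale_left braket_axis \<psi>_nth r mult_ac)
  then have unit: "braket \<psi> \<psi> = 1"
    by (simp add: r)
  obtain b\<^sub>0 b\<^sub>1 where b: "b\<^sub>0 \<in> B" "b\<^sub>1 \<in> B" "b\<^sub>0 \<noteq> b\<^sub>1"
    using B by (auto simp: card_le_Suc_iff numeral_2_eq_2)
  define M where "M b = (if b = b\<^sub>0 then ketbra \<psi> \<psi> else if b = b\<^sub>1 then mat 1 - ketbra \<psi> \<psi> else 0)" for b
  have povm: "povm B M"
    unfolding M_def using psd_ketbra psd_one_minus_ketbra[OF unit] fin(2) b by (rule povm_two_outcomes)
  \<comment> \<open>All other senders use bit 0, which is the identity channel.\<close>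
  define E where "E k x = phase_encoding (if k = i then c x else if k = j then d x else 0)" for k x
  have "npe (E k x)" for k x
    unfolding E_def phase_encoding_eq by (rule npe_single) (simp add: norm_power)
  then obtain p where p: "realizes_mac A B \<rho> E M p"
    using realizes_mac_Re_trace[OF \<rho> povm] by blast
  obtain a where a: "\<And>k. a k \<in> A k"
    using ne that[of "\<lambda>k. SOME x. x \<in> A k"] by (simp add: some_in_eq)
  have "0 \<in> c ` A i" "1 \<in> c ` A i" "0 \<in> d ` A j" "1 \<in> d ` A j"
    using c d by simp_all
  then obtain x x' y y' where x: "x \<in> A i" "x' \<in> A i" "0 = c x" "1 = c x'"
    and y: "y \<in> A j" "y' \<in> A j" "0 = d y" "1 = d y'"
    unfolding image_iff by (elim bexE)
  \<comment> \<open>Bit 0 has damping 1 and bit 1 has damping -1, the farthest apart that damping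
    factors can be.\<close>
  have "damping (E i x) - damping (E i x') = 2" "cnj (damping (E j y) - damping (E j y')) = 2"
    using \<open>i \<noteq> j\<close> x(3,4)[symmetric] y(3,4)[symmetric]
    by (simp_all add: E_def phase_encoding_eq damping_npe_kraus)
  moreover have "M b\<^sub>0 $ occ j $ occ i = u / 2"
    by (simp add: M_def ketbra_def \<psi>_nth r mult.assoc)
  ultimately have "second_difference i j (p b\<^sub>0) a x x' y y' = 2 * Re (2 * (u * coherence \<rho> i j))"
    using a x y b
    by (subst realizes_mac_second_difference[OF \<rho> \<open>i \<noteq> j\<close> p])
      (simp_all only: Pi_iff, simp_all)
  then have "second_difference i j (p b\<^sub>0) a x x' y y' = 4 * cmod (coherence \<rho> i j)"
    by (simp only: u(2)) simp
  then have "4 * cmod (coherence \<rho> i j) = \<bar>second_difference i j (p b\<^sub>0) a x x' y y'\<bar>"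
    by simp
  also have "\<dots> \<le> I2_mac A B i j p"
    unfolding I2_mac_eq using a x y b
    by (intro Max_ge finite_second_difference_values fin) blast
  finally have "4 * cmod (coherence \<rho> i j) \<le> I2_mac A B i j p" .
  moreover have "I2_mac A B i j p \<le> 4 * cmod (coherence \<rho> i j)"
    using p b fin ne \<rho> \<open>i \<noteq> j\<close> by (intro I2_mac_le) (auto simp: quantum_macs_def)
  ultimately have "I2_mac A B i j p = 4 * cmod (coherence \<rho> i j)"
    by simp
  with p \<open>i \<noteq> j\<close> show ?thesis
    by (intro exI[of _ E] exI[of _ M] exI[of _ p]) (simp add: E_def)
qed

text \<open>One element goes to 0 and all others to 1, so every admissible input set carries a phase
  encoding.\<close>

lemma ex_onto_bits:
  assumes "card S \<ge> 2"
  shows "\<exists>c :: _ \<Rightarrow> nat. c ` S = {0, 1}"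
proof -
  obtain x y where "x \<in> S" "y \<in> S" "x \<noteq> y"
    using assms by (auto simp: card_le_Suc_iff numeral_2_eq_2)
  then have "(\<lambda>z. if z = x then 0 else 1 :: nat) ` S = {0, 1}"
    by (auto simp: image_iff)
  then show ?thesis by blast
qed

text \<open>The second and third conjuncts certify that the \<open>GREATEST\<close> in
  \<open>I2_state\<close> denotes an actual maximum.\<close>

theorem proposition9:
  fixes A :: "'n::finite \<Rightarrow> 'a set" and B :: "'b set"
    and \<rho> :: "'n joint_op" and i j :: 'n
  assumes "\<And>k. finite (A k)" and "\<And>k. card (A k) \<ge> 2"
    and "finite B" and "card B \<ge> 2"
    and "one_particle_density \<rho>"
    and "i \<noteq> j"
  shows "I2_state A B i j \<rho> = 4 * cmod (coherence \<rho> i j)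
    \<and> (\<forall>p\<in>quantum_macs A B \<rho>. I2_mac A B i j p \<le> I2_state A B i j \<rho>)
    \<and> (\<exists>p\<in>quantum_macs A B \<rho>. I2_mac A B i j p = I2_state A B i j \<rho>)
    \<and> (\<forall>c d :: 'a \<Rightarrow> nat. c ` A i = {0, 1} \<longrightarrow> d ` A j = {0, 1} \<longrightarrow>
        (\<exists>E M p. realizes_mac A B \<rho> E M p
          \<and> (\<forall>x\<in>A i. E i x = phase_encoding (c x))
          \<and> (\<forall>y\<in>A j. E j y = phase_encoding (d y))
          \<and> I2_mac A B i j p = I2_state A B i j \<rho>))"
proof -
  have ne: "A k \<noteq> {}" for k
    using assms(2)[of k] by auto
  have le: "I2_mac A B i j p \<le> 4 * cmod (coherence \<rho> i j)" if "p \<in> quantum_macs A B \<rho>" for p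
    using assms ne that by (intro I2_mac_le) auto
  have enc: "\<exists>E M p. realizes_mac A B \<rho> E M p
      \<and> (\<forall>x\<in>A i. E i x = phase_encoding (c x)) \<and> (\<forall>y\<in>A j. E j y = phase_encoding (d y))
      \<and> I2_mac A B i j p = 4 * cmod (coherence \<rho> i j)"
    if "c ` A i = {0, 1}" "d ` A j = {0, 1}" for c d :: "'a \<Rightarrow> nat"
    using assms ne that by (intro phase_encoding_attains) auto
  \<comment> \<open>A single encoding supplies the MAC that attains the maximum.\<close>
  obtain c :: "'a \<Rightarrow> nat" where "c ` A i = {0, 1}"
    using ex_onto_bits[OF assms(2)[of i]] by (elim exE)
  moreover obtain d :: "'a \<Rightarrow> nat" where "d ` A j = {0, 1}"
    using ex_onto_bits[OF assms(2)[of j]] by (elim exE)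
  ultimately obtain E M p where "realizes_mac A B \<rho> E M p"
    and p: "I2_mac A B i j p = 4 * cmod (coherence \<rho> i j)"
    using enc[of c d] by (metis (no_types))
  then have p_mem: "p \<in> quantum_macs A B \<rho>"
    by (auto simp: quantum_macs_def)
  have I2: "I2_state A B i j \<rho> = 4 * cmod (coherence \<rho> i j)"
    unfolding I2_state_def
  proof (rule Greatest_equality)
    show "4 * cmod (coherence \<rho> i j) \<in> I2_mac A B i j ` quantum_macs A B \<rho>"
      using p p_mem by (intro image_eqI[of _ _ p]) simp_all
  qed (use le in auto)
  show ?thesis
    unfolding I2 using le p p_mem enc by (intro conjI ballI bexI[of _ p] allI impI) simp_all
qed

end
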